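(* Let $H$ be a real Hilbert space, let $A$ and $B$ be closed and convex sets in $H$, let $x_0, q\in H$ and $\alpha,\beta\in(0,1)$, and let $\{x_n\}$ and $\{y_n\}$ be the sequences generated from $x_0$ by $$y_n=P_A(x_n+q),\qquad x_{n+1}=T_{A-q,B-q,\alpha,\beta}(x_n),\qquad n=0,1,2,\dots.$$ If $A\cap B\neq\emptyset$ and $q-P_{A\cap B}(q)\in (N_A+N_B)(P_{A\cap B}(q))$, then $\{y_n\}$ converges weakly to $P_{A\cap B}(q)$.
   Context: $H$ is a real Hilbert space with inner product $\langle\cdot,\cdot\rangle$ and norm $\|\cdot\|$. For a nonempty closed convex set $C\subset H$, $P_C$ denotes the metric projection onto $C$: $P_C(x)$ is the unique minimizer of $\|x-y\|$ over $y\in C$. For $x\in C$, the normal cone to $C$ at $x$ is $N_C(x)=\{v\in H:\langle v,y-x\rangle\le 0 \text{ for all } y\in C\}$, and $(N_A+N_B)(x)=N_A(x)+N_B(x)=\{v+w: v\in N_A(x),\ w\in N_B(x)\}$. For $C\subset H$ and $p\in H$, $C-p=\{c-p:c\in C\}$. For nonempty closed convex sets $C,D\subset H$ and $\alpha,\beta\in(0,1)$, the averaged alternating modified reflections (AAMR) operator $T_{C,D,\alpha,\beta}:H\to H$ is $$T_{C,D,\alpha,\beta}=(1-\alpha)I+\alpha(2\beta P_D-I)(2\beta P_C-I),$$ where $I$ is the identity mapping and juxtaposition denotes composition. *)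

theory Defs
  imports "HOL-Analysis.Analysis"
begin

text \<open>
  A real Hilbert space is a type of class \<open>{real_inner, complete_space}\<close>.
  The library's \<open>closest_point\<close> requires \<open>heine_borel\<close>, i.e. finite dimension, so the metric
  projection is defined afresh. For \<open>C\<close> empty, or not closed and convex, the minimizer need not
  exist or be unique, and then the value is unspecified.
\<close>

definition metric_proj :: "'a::real_inner set \<Rightarrow> 'a \<Rightarrow> 'a" where
  "metric_proj C x = (THE p. p \<in> C \<and> (\<forall>y\<in>C. norm (x - p) \<le> norm (x - y)))"

text \<open>Outside \<open>C\<close> the normal cone is empty, as is usual for set-valued operators.\<close>

definition normal_cone :: "'a::real_inner set \<Rightarrow> 'a \<Rightarrow> 'a set" where
  "normal_cone C x = (if x \<in> C then {v. \<forall>y\<in>C. inner v (y - x) \<le> 0} else {})"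

definition modified_reflection :: "'a::real_inner set \<Rightarrow> real \<Rightarrow> 'a \<Rightarrow> 'a" where
  "modified_reflection C \<beta> x = (2 * \<beta>) *\<^sub>R metric_proj C x - x"

definition aamr :: "'a::real_inner set \<Rightarrow> 'a set \<Rightarrow> real \<Rightarrow> real \<Rightarrow> 'a \<Rightarrow> 'a" where
  "aamr C D \<alpha> \<beta> x =
     (1 - \<alpha>) *\<^sub>R x + \<alpha> *\<^sub>R (modified_reflection D \<beta> \<circ> modified_reflection C \<beta>) x"

definition weakly_converges :: "(nat \<Rightarrow> 'a::real_normed_vector) \<Rightarrow> 'a \<Rightarrow> bool" where
  "weakly_converges u l \<longleftrightarrow>
     (\<forall>f :: 'a \<Rightarrow> real. bounded_linear f \<longrightarrow> (\<lambda>n. f (u n)) \<longlonglongrightarrow> f l)"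

end

theory Submission
  imports Defs
begin

text \<open>
  Translating by \<open>q\<close> reduces to \<open>C = A - q\<close>, \<open>D = B - q\<close> and \<open>p = P\<^bsub>A \<inter> B\<^esub>(q) - q\<close>.
  If \<open>-p = v + w\<close> with \<open>v \<in> N\<^sub>C(p)\<close> and \<open>w \<in> N\<^sub>D(p)\<close>, then \<open>z = p + 2 (1 - \<beta>) v\<close> satisfies
  \<open>P\<^sub>C(z) = p\<close> and \<open>P\<^sub>D(2 \<beta> p - z) = p\<close>, so \<open>z\<close> is a fixed point of the operator. Since projections
  are firmly nonexpansive, a modified reflection decreases squared distances by at
  least \<open>4 \<beta> (1 - \<beta>)\<close> times the squared distance of the projections. Hence \<open>\<parallel>x\<^sub>n - z\<parallel>\<^sup>2\<close> decreases
  by at least a positive multiple of \<open>\<parallel>P\<^sub>C(x\<^sub>n) - p\<parallel>\<^sup>2\<close>, which therefore tends to \<open>0\<close>: the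
  convergence of \<open>y\<^sub>n\<close> is even strong.
\<close>

section \<open>Nearest points, normal cones and the metric projection\<close>

text \<open>Without compactness, completeness supplies the minimizer: the near-minimizers form
  nested closed sets, and the parallelogram law makes their diameters shrink to 0.\<close>

lemma exists_nearest_point:
  fixes C :: "'a::{real_inner, complete_space} set"
  assumes "closed C" and "convex C" and "C \<noteq> {}"
  shows "\<exists>p\<in>C. \<forall>y\<in>C. norm (x - p) \<le> norm (x - y)"
proof -
  define d where "d = infdist x C"
  have d: "0 \<le> d" "\<And>y. y \<in> C \<Longrightarrow> d \<le> norm (x - y)"
    by (auto simp: d_def infdist_nonneg infdist_le dist_norm[symmetric])
  define S where "S n = C \<inter> cball x (d + 1 / real (Suc n))" for n
  have gap: "(norm (u - v))\<^sup>2 \<le> 8 * d * e + 4 * e\<^sup>2"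
    if uv: "u \<in> C" "v \<in> C" "norm (x - u) \<le> d + e" "norm (x - v) \<le> d + e" for u v e
  proof -
    \<comment> \<open>Convexity enters only here: the midpoint is no closer to \<open>x\<close> than
      \<open>d\<close>. The identity for \<open>norm (u - v)\<close> below is the parallelogram law
      for \<open>x - u\<close> and \<open>x - v\<close>.\<close>
    have "(1/2) *\<^sub>R u + (1/2) *\<^sub>R v \<in> C"
      using \<open>convex C\<close> uv by (auto simp: convex_def)
    then have "d \<le> norm (x - ((1/2) *\<^sub>R u + (1/2) *\<^sub>R v))"
      by (rule d)
    then have mid: "d\<^sup>2 \<le> (norm (x - ((1/2) *\<^sub>R u + (1/2) *\<^sub>R v)))\<^sup>2"
      using d(1) by (rule power_mono)
    have "(norm (u - v))\<^sup>2 = 2 * (norm (x - u))\<^sup>2 + 2 * (norm (x - v))\<^sup>2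
        - 4 * (norm (x - ((1/2) *\<^sub>R u + (1/2) *\<^sub>R v)))\<^sup>2"
      by (simp add: power2_norm_eq_inner inner_add inner_diff inner_commute algebra_simps)
    also have "\<dots> \<le> 2 * (d + e)\<^sup>2 + 2 * (d + e)\<^sup>2 - 4 * d\<^sup>2"
      using mid power_mono[OF uv(3), of 2] power_mono[OF uv(4), of 2] by simp
    also have "\<dots> = 8 * d * e + 4 * e\<^sup>2"
      by (simp add: power2_eq_square algebra_simps)
    finally show ?thesis .
  qed
  have "\<exists>a. \<forall>n. a \<in> S n"
  proof (rule decreasing_closed_nest)
    show "closed (S n)" for n
      using \<open>closed C\<close> by (simp add: S_def closed_Int)
    show "S n \<noteq> {}" for n
    proof -
      have "infdist x C < d + 1 / real (Suc n)"
        by (simp add: d_def)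
      then obtain a where "a \<in> C" "dist x a < d + 1 / real (Suc n)"
        using \<open>C \<noteq> {}\<close> cInf_lessD[of "dist x ` C"] by (auto simp: infdist_notempty)
      then show ?thesis
        by (force simp: S_def)
    qed
    show "S n \<subseteq> S m" if "m \<le> n" for m n
    proof -
      have "1 / real (Suc n) \<le> 1 / real (Suc m)"
        using that by (simp add: divide_simps)
      then show ?thesis
        by (auto simp: S_def)
    qed
    show "\<exists>n. \<forall>u\<in>S n. \<forall>v\<in>S n. dist u v < e" if "0 < e" for e
    proof -
      have "(\<lambda>n. 8 * d * (1 / real (Suc n)) + 4 * (1 / real (Suc n))\<^sup>2) \<longlonglongrightarrow> 8 * d * 0 + 4 * 0\<^sup>2"
        by (intro tendsto_intros LIMSEQ_inverse_real_of_nat[unfolded inverse_eq_divide])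
      then have "\<forall>\<^sub>F n in sequentially. 8 * d * (1 / real (Suc n)) + 4 * (1 / real (Suc n))\<^sup>2 < e\<^sup>2"
        by (rule order_tendstoD) (use that in simp)
      then obtain n where n: "8 * d * (1 / real (Suc n)) + 4 * (1 / real (Suc n))\<^sup>2 < e\<^sup>2"
        by (auto simp: eventually_sequentially)
      have "dist u v < e" if "u \<in> S n" "v \<in> S n" for u v
      proof -
        have "(norm (u - v))\<^sup>2 \<le> 8 * d * (1 / real (Suc n)) + 4 * (1 / real (Suc n))\<^sup>2"
          using that by (intro gap) (auto simp: S_def dist_norm)
        then have "(norm (u - v))\<^sup>2 < e\<^sup>2"
          using n by linarith
        then show ?thesis
          using \<open>0 < e\<close> by (simp add: dist_norm power2_less_imp_less)
      qed
      then show ?thesis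
        by blast
    qed
  qed blast
  then obtain p where p: "\<And>n. p \<in> C" "\<And>n. norm (x - p) \<le> d + 1 / real (Suc n)"
    by (auto simp: S_def dist_norm)
  have "(\<lambda>n. d + 1 / real (Suc n)) \<longlonglongrightarrow> d + 0"
    by (intro tendsto_intros LIMSEQ_inverse_real_of_nat[unfolded inverse_eq_divide])
  then have "norm (x - p) \<le> d + 0"
    by (rule LIMSEQ_le_const) (use p(2) in blast)
  then show ?thesis
    using p(1) d(2) by (auto intro!: bexI[of _ p] intro: order_trans)
qed

lemma nearest_point_iff_normal:
  fixes C :: "'a::real_inner set"
  assumes "convex C" and "p \<in> C"
  shows "(\<forall>y\<in>C. norm (x - p) \<le> norm (x - y)) \<longleftrightarrow> x - p \<in> normal_cone C p"
proof
  assume near: "\<forall>y\<in>C. norm (x - p) \<le> norm (x - y)"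
  have "inner (x - p) (y - p) \<le> 0" if "y \<in> C" for y
  \<comment> \<open>Compare \<open>p\<close> with the point of the segment from \<open>p\<close> to
    \<open>y\<close> at parameter \<open>t\<close>, cancel one factor \<open>t\<close>, and let
    \<open>t\<close> tend to 0 from the right.\<close>
  proof (rule tendsto_lowerbound)
    show "((\<lambda>t. t * (norm (y - p))\<^sup>2 / 2) \<longlongrightarrow> 0) (at_right 0)"
      by (auto intro!: tendsto_eq_intros)
    have "inner (x - p) (y - p) \<le> t * (norm (y - p))\<^sup>2 / 2" if t: "0 < t" "t < 1" for t
    proof -
      have "(1 - t) *\<^sub>R p + t *\<^sub>R y \<in> C"
        using assms \<open>y \<in> C\<close> t by (auto simp: convex_alt)
      then have "norm (x - p) \<le> norm (x - ((1 - t) *\<^sub>R p + t *\<^sub>R y))"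
        using near by blast
      also have "x - ((1 - t) *\<^sub>R p + t *\<^sub>R y) = (x - p) - t *\<^sub>R (y - p)"
        by (simp add: algebra_simps)
      finally have "(norm (x - p))\<^sup>2 \<le> (norm ((x - p) - t *\<^sub>R (y - p)))\<^sup>2"
        by (rule power_mono) simp
      then have "t * (2 * inner (x - p) (y - p)) \<le> t * (t * (norm (y - p))\<^sup>2)"
        unfolding power2_norm_eq_inner inner_diff_left[of "x - p"] inner_diff_right[of _ "x - p"]
        by (simp add: inner_commute)
      then show ?thesis
        using t by simp
    qed
    then show "\<forall>\<^sub>F t in at_right 0. inner (x - p) (y - p) \<le> t * (norm (y - p))\<^sup>2 / 2"
      by (auto simp: eventually_at_right_field intro!: exI[of _ 1])
  qed simp
  then show "x - p \<in> normal_cone C p"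
    using \<open>p \<in> C\<close> by (simp add: normal_cone_def)
next
  assume nc: "x - p \<in> normal_cone C p"
  show "\<forall>y\<in>C. norm (x - p) \<le> norm (x - y)"
  proof
    fix y assume "y \<in> C"
    then have "inner (x - p) (y - p) \<le> 0"
      using nc \<open>p \<in> C\<close> by (simp add: normal_cone_def)
    moreover have "(norm (x - y))\<^sup>2 = (norm (x - p))\<^sup>2 + (norm (y - p))\<^sup>2 - 2 * inner (x - p) (y - p)"
      by (simp add: power2_norm_eq_inner inner_diff inner_commute)
    ultimately have "(norm (x - p))\<^sup>2 \<le> (norm (x - y))\<^sup>2"
      by (smt (verit) zero_le_power2)
    then show "norm (x - p) \<le> norm (x - y)"
      by (rule power2_le_imp_le) simp
  qed
qed

text \<open>Test each normal vector against the other base point and add the two inequalities.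
  Stated without \<open>metric_proj\<close>, so that the case \<open>x = x'\<close> can give the
  uniqueness on which \<open>THE\<close> in \<open>metric_proj\<close> relies.\<close>

lemma normal_cone_firmly_nonexpansive:
  fixes p p' :: "'a::real_inner"
  assumes "x - p \<in> normal_cone C p" and "x' - p' \<in> normal_cone C p'"
  shows "(norm (p - p'))\<^sup>2 \<le> inner (p - p') (x - x')"
proof -
  have mem: "p \<in> C" "p' \<in> C"
    using assms by (auto simp: normal_cone_def split: if_splits)
  then have "inner (x - p) (p' - p) \<le> 0" "inner (x' - p') (p - p') \<le> 0"
    using assms by (auto simp: normal_cone_def)
  then show ?thesis
    by (simp add: power2_norm_eq_inner inner_diff inner_commute)
qed

lemma metric_proj_eqI:
  fixes C :: "'a::real_inner set"
  assumes "convex C" and "x - p \<in> normal_cone C p"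
  shows "metric_proj C x = p"
  unfolding metric_proj_def
proof (rule the_equality)
  have "p \<in> C"
    using assms(2) by (auto simp: normal_cone_def split: if_splits)
  then show "p \<in> C \<and> (\<forall>y\<in>C. norm (x - p) \<le> norm (x - y))"
    using nearest_point_iff_normal[OF \<open>convex C\<close>] assms(2) by blast
next
  fix r assume "r \<in> C \<and> (\<forall>y\<in>C. norm (x - r) \<le> norm (x - y))"
  then have "x - r \<in> normal_cone C r"
    using nearest_point_iff_normal[OF \<open>convex C\<close>] by blast
  from normal_cone_firmly_nonexpansive[OF this assms(2)] show "r = p"
    by simp
qed

lemma metric_proj_normal:
  fixes C :: "'a::{real_inner, complete_space} set"
  assumes "closed C" and "convex C" and "C \<noteq> {}"
  shows "x - metric_proj C x \<in> normal_cone C (metric_proj C x)"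
proof -
  obtain p where "p \<in> C" "\<forall>y\<in>C. norm (x - p) \<le> norm (x - y)"
    using exists_nearest_point[OF assms] by blast
  then have "x - p \<in> normal_cone C p"
    using nearest_point_iff_normal[OF \<open>convex C\<close>] by blast
  with metric_proj_eqI[OF \<open>convex C\<close> this] show ?thesis
    by simp
qed

lemma normal_cone_translate:
  "normal_cone ((\<lambda>c. c - q) ` C) (p - q) = normal_cone C p"
  by (auto simp: normal_cone_def)

lemma metric_proj_translate:
  fixes C :: "'a::{real_inner, complete_space} set"
  assumes "closed C" and "convex C" and "C \<noteq> {}"
  shows "metric_proj ((\<lambda>c. c - q) ` C) x = metric_proj C (x + q) - q"
proof (rule metric_proj_eqI)
  show "convex ((\<lambda>c. c - q) ` C)"
    using \<open>convex C\<close> by simp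
  show "x - (metric_proj C (x + q) - q)
      \<in> normal_cone ((\<lambda>c. c - q) ` C) (metric_proj C (x + q) - q)"
    using metric_proj_normal[OF assms, of "x + q"]
    by (simp add: normal_cone_translate algebra_simps)
qed

section \<open>Contraction estimates and a fixed point of the operator\<close>

text \<open>Expand the square of \<open>(2 * \<beta>) *\<^sub>R d - (x - y)\<close> and bound the
  cross term by firm nonexpansiveness. The gain vanishes at \<beta> = 1, the ordinary reflection;
  for 0 < \<beta> < 1 it controls the projections themselves.\<close>

lemma modified_reflection_dist_le:
  fixes C :: "'a::{real_inner, complete_space} set"
  assumes "closed C" and "convex C" and "C \<noteq> {}" and "0 \<le> \<beta>"
  shows "(norm (modified_reflection C \<beta> x - modified_reflection C \<beta> y))\<^sup>2
    \<le> (norm (x - y))\<^sup>2 - 4 * \<beta> * (1 - \<beta>) * (norm (metric_proj C x - metric_proj C y))\<^sup>2"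
proof -
  define d where "d = metric_proj C x - metric_proj C y"
  have "(norm d)\<^sup>2 \<le> inner d (x - y)"
    unfolding d_def
    using metric_proj_normal[OF assms(1-3)]
    by (intro normal_cone_firmly_nonexpansive[where C = C])
  then have le: "4 * \<beta> * (norm d)\<^sup>2 \<le> 4 * \<beta> * inner d (x - y)"
    using \<open>0 \<le> \<beta>\<close> by (intro mult_left_mono) auto
  have eq: "modified_reflection C \<beta> x - modified_reflection C \<beta> y = (2 * \<beta>) *\<^sub>R d - (x - y)"
    by (simp add: modified_reflection_def d_def algebra_simps)
  have "(norm ((2 * \<beta>) *\<^sub>R d - (x - y)))\<^sup>2
      = 4 * \<beta>\<^sup>2 * (norm d)\<^sup>2 - 4 * \<beta> * inner d (x - y) + (norm (x - y))\<^sup>2"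
    unfolding power2_norm_eq_inner inner_diff_left[of "_ *\<^sub>R d"] inner_diff_right[of _ "_ *\<^sub>R d"]
    by (simp add: inner_commute power2_eq_square)
  also have "\<dots> \<le> (norm (x - y))\<^sup>2 - 4 * \<beta> * (1 - \<beta>) * (norm d)\<^sup>2"
    using le by (simp add: power2_eq_square algebra_simps)
  finally show ?thesis
    by (simp add: eq d_def[symmetric])
qed

lemma norm_convex_combination_power2_le:
  fixes u v :: "'a::real_inner"
  assumes "0 \<le> \<alpha>" and "\<alpha> \<le> 1"
  shows "(norm ((1 - \<alpha>) *\<^sub>R u + \<alpha> *\<^sub>R v))\<^sup>2 \<le> (1 - \<alpha>) * (norm u)\<^sup>2 + \<alpha> * (norm v)\<^sup>2"
proof -
  \<comment> \<open>The defect in the convexity of the squared norm is computed exactly.\<close>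
  have "(1 - \<alpha>) * (norm u)\<^sup>2 + \<alpha> * (norm v)\<^sup>2 - (norm ((1 - \<alpha>) *\<^sub>R u + \<alpha> *\<^sub>R v))\<^sup>2
      = \<alpha> * (1 - \<alpha>) * (norm (u - v))\<^sup>2"
    by (simp add: power2_norm_eq_inner inner_add inner_diff inner_commute algebra_simps)
  also have "\<dots> \<ge> 0"
    using assms by simp
  finally show ?thesis
    by simp
qed

lemma aamr_dist_le:
  fixes C D :: "'a::{real_inner, complete_space} set"
  assumes "closed C" and "convex C" and "C \<noteq> {}"
    and "closed D" and "convex D" and "D \<noteq> {}"
    and "0 \<le> \<alpha>" and "\<alpha> \<le> 1" and "0 \<le> \<beta>" and "\<beta> \<le> 1"
  shows "(norm (aamr C D \<alpha> \<beta> x - aamr C D \<alpha> \<beta> y))\<^sup>2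
    \<le> (norm (x - y))\<^sup>2 - 4 * \<alpha> * \<beta> * (1 - \<beta>) * (norm (metric_proj C x - metric_proj C y))\<^sup>2"
proof -
  let ?R = "modified_reflection D \<beta> \<circ> modified_reflection C \<beta>"
  let ?m = "(norm (metric_proj C x - metric_proj C y))\<^sup>2"
  \<comment> \<open>The outer reflection is used only as a nonexpansive map; the gain kept is that
    of the inner one, which involves the projections onto \<open>C\<close>.\<close>
  have "(norm (?R x - ?R y))\<^sup>2
      \<le> (norm (modified_reflection C \<beta> x - modified_reflection C \<beta> y))\<^sup>2"
    unfolding comp_apply
    by (rule order_trans[OF modified_reflection_dist_le]) (use assms in simp_all)
  also have "\<dots> \<le> (norm (x - y))\<^sup>2 - 4 * \<beta> * (1 - \<beta>) * ?m"
    by (intro modified_reflection_dist_le assms)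
  finally have R: "\<alpha> * (norm (?R x - ?R y))\<^sup>2 \<le> \<alpha> * ((norm (x - y))\<^sup>2 - 4 * \<beta> * (1 - \<beta>) * ?m)"
    using \<open>0 \<le> \<alpha>\<close> by (rule mult_left_mono)
  have "aamr C D \<alpha> \<beta> x - aamr C D \<alpha> \<beta> y = (1 - \<alpha>) *\<^sub>R (x - y) + \<alpha> *\<^sub>R (?R x - ?R y)"
    by (simp add: aamr_def algebra_simps)
  then have "(norm (aamr C D \<alpha> \<beta> x - aamr C D \<alpha> \<beta> y))\<^sup>2
      \<le> (1 - \<alpha>) * (norm (x - y))\<^sup>2 + \<alpha> * (norm (?R x - ?R y))\<^sup>2"
    using norm_convex_combination_power2_le[OF assms(7,8)] by metis
  with R show ?thesis
    by (simp add: algebra_simps)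
qed

text \<open>Nonnegative multiples of normal vectors are normal. The factor 2 (1 - \<beta>) in
  \<open>z\<close> is chosen so that \<open>(2 * \<beta>) *\<^sub>R p - z - p\<close> is the same
  multiple of \<open>w\<close> as \<open>z - p\<close> is of \<open>v\<close>. Both projections then
  return \<open>p\<close>, and the second reflection undoes the first at \<open>z\<close>.\<close>

lemma aamr_fixed_point:
  fixes C D :: "'a::real_inner set"
  assumes "convex C" and "convex D" and "\<beta> \<le> 1"
    and "v \<in> normal_cone C p" and "w \<in> normal_cone D p" and "- p = v + w"
  defines "z \<equiv> p + (2 * (1 - \<beta>)) *\<^sub>R v"
  shows "metric_proj C z = p" and "aamr C D \<alpha> \<beta> z = z"
proof -
  have cone: "(2 * (1 - \<beta>)) *\<^sub>R u \<in> normal_cone S p" if "u \<in> normal_cone S p" for u S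
    using that \<open>\<beta> \<le> 1\<close> by (auto simp: normal_cone_def mult_nonneg_nonpos split: if_splits)
  show C: "metric_proj C z = p"
    using cone[OF assms(4)] by (intro metric_proj_eqI assms) (simp add: z_def)
  have w: "w = - p - v"
    using \<open>- p = v + w\<close> by simp
  have "(2 * \<beta>) *\<^sub>R p - z - p = (2 * (1 - \<beta>)) *\<^sub>R w"
    unfolding w z_def by (simp add: algebra_simps scaleR_2)
  then have "metric_proj D ((2 * \<beta>) *\<^sub>R p - z) = p"
    using cone[OF assms(5)] by (intro metric_proj_eqI assms) simp
  with C show "aamr C D \<alpha> \<beta> z = z"
    by (simp add: aamr_def modified_reflection_def algebra_simps)
qed

section \<open>Convergence of the projected iterates\<close>

text \<open>\<open>V\<close> decreases and is bounded below, so it converges; its consecutive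
  differences tend to 0 and dominate \<open>g\<close>.\<close>

lemma tendsto_zero_if_bounded_by_decrements:
  fixes V g :: "nat \<Rightarrow> real"
  assumes "\<And>n. 0 \<le> V n" and "\<And>n. 0 \<le> g n" and "\<And>n. V (Suc n) \<le> V n - g n"
  shows "g \<longlonglongrightarrow> 0"
proof -
  have "decseq V"
    using assms(2,3) by (intro decseq_SucI) (smt (verit))
  then obtain L where "V \<longlonglongrightarrow> L"
    using decseq_convergent assms(1) by blast
  then have "(\<lambda>n. V n - V (Suc n)) \<longlonglongrightarrow> L - L"
    by (intro tendsto_diff LIMSEQ_Suc)
  then have lim: "(\<lambda>n. V n - V (Suc n)) \<longlonglongrightarrow> 0"
    by simp
  show ?thesis
    by (rule tendsto_sandwich[OF _ _ tendsto_const lim])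
      (use assms in \<open>auto simp: algebra_simps intro!: always_eventually\<close>)
qed

text \<open>The assumption on \<open>- p\<close> makes \<open>p\<close> the projection of 0 onto the
  intersection of \<open>C\<close> and \<open>D\<close>, and its decomposition yields the fixed
  point \<open>z\<close>. The squared distance of \<open>x n\<close> to \<open>z\<close> serves as
  the decreasing quantity.\<close>

lemma aamr_shadow_tendsto:
  fixes C D :: "'a::{real_inner, complete_space} set"
  assumes "closed C" and "convex C" and "closed D" and "convex D"
    and "0 < \<alpha>" and "\<alpha> \<le> 1" and "0 < \<beta>" and "\<beta> < 1"
    and step: "\<And>n. x (Suc n) = aamr C D \<alpha> \<beta> (x n)"
    and normal: "- p \<in> normal_cone C p + normal_cone D p"
  shows "(\<lambda>n. metric_proj C (x n)) \<longlonglongrightarrow> p"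
proof -
  obtain v w where vw: "v \<in> normal_cone C p" "w \<in> normal_cone D p" "- p = v + w"
    using normal by (rule set_plus_elim)
  then have ne: "C \<noteq> {}" "D \<noteq> {}"
    by (auto simp: normal_cone_def split: if_splits)
  obtain z where z: "metric_proj C z = p" "aamr C D \<alpha> \<beta> z = z"
    using aamr_fixed_point[OF assms(2,4) less_imp_le[OF \<open>\<beta> < 1\<close>] vw] that by blast
  define c where "c = 4 * \<alpha> * \<beta> * (1 - \<beta>)"
  have "c > 0"
    using assms by (simp add: c_def)
  have "(\<lambda>n. c * (norm (metric_proj C (x n) - p))\<^sup>2) \<longlonglongrightarrow> 0"
  proof (rule tendsto_zero_if_bounded_by_decrements)
    show "(norm (x (Suc n) - z))\<^sup>2 \<le> (norm (x n - z))\<^sup>2 - c * (norm (metric_proj C (x n) - p))\<^sup>2" for n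
      using aamr_dist_le[of C D \<alpha> \<beta> "x n" z] assms ne z by (simp add: c_def)
  qed (use \<open>c > 0\<close> in auto)
  then have "(\<lambda>n. (1 / c) * (c * (norm (metric_proj C (x n) - p))\<^sup>2)) \<longlonglongrightarrow> (1 / c) * 0"
    by (rule tendsto_mult_left)
  then have "(\<lambda>n. sqrt ((norm (metric_proj C (x n) - p))\<^sup>2)) \<longlonglongrightarrow> sqrt 0"
    using \<open>c > 0\<close> by (intro tendsto_real_sqrt) simp
  then show ?thesis
    by (simp add: tendsto_norm_zero_iff LIM_zero_iff)
qed

lemma tendsto_imp_weakly_converges:
  assumes "u \<longlonglongrightarrow> l"
  shows "weakly_converges u l"
  using assms by (auto simp: weakly_converges_def intro: bounded_linear.tendsto)

theorem theorem3p1: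
  fixes A B :: "'a::{real_inner, complete_space} set"
    and x0 q :: 'a
    and \<alpha> \<beta> :: real
    and x y :: "nat \<Rightarrow> 'a"
  assumes "closed A" and "convex A"
    and "closed B" and "convex B"
    and "0 < \<alpha>" and "\<alpha> < 1"
    and "0 < \<beta>" and "\<beta> < 1"
    and "x 0 = x0"
    and "\<And>n. y n = metric_proj A (x n + q)"
    and "\<And>n. x (Suc n) = aamr ((\<lambda>a. a - q) ` A) ((\<lambda>b. b - q) ` B) \<alpha> \<beta> (x n)"
    and "A \<inter> B \<noteq> {}"
    and "q - metric_proj (A \<inter> B) q
           \<in> normal_cone A (metric_proj (A \<inter> B) q) + normal_cone B (metric_proj (A \<inter> B) q)"
  shows "weakly_converges y (metric_proj (A \<inter> B) q)"
proof (rule tendsto_imp_weakly_converges)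
  let ?C = "(\<lambda>a. a - q) ` A" and ?D = "(\<lambda>b. b - q) ` B"
  let ?p = "metric_proj (A \<inter> B) q - q"
  have "(\<lambda>n. metric_proj ?C (x n)) \<longlonglongrightarrow> ?p"
  proof (rule aamr_shadow_tendsto)
    show "closed ?C" "closed ?D" "convex ?C" "convex ?D"
      using assms(1-4) by (simp_all add: closed_translation_subtract)
    \<comment> \<open>\<open>- ?p\<close> is \<open>q - metric_proj (A \<inter> B) q\<close>, and
      translating set and base point together leaves normal cones unchanged.\<close>
    show "- ?p \<in> normal_cone ?C ?p + normal_cone ?D ?p"
      using assms(13) by (simp add: normal_cone_translate)
  qed (use assms in auto)
  moreover have "metric_proj ?C (x n) = y n - q" for n
    using assms by (subst metric_proj_translate) auto
  ultimately show "y \<longlonglongrightarrow> metric_proj (A \<inter> B) q"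
    using tendsto_add[OF _ tendsto_const[of q]] by fastforce
qed

end
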